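(* There is an absolute constant $C > 0$ such that for every $n \geq 2$ and every simple graph $G$ on $n$ vertices, $$\max\{\lambda(G), \lambda(\bar{G})\} \geq 1 - C\, n^{-1/3},$$ where $\bar{G}$ is the complement of $G$.
   Context: For a simple graph $G$ on $n$ vertices, $L(G) = D(G) - A(G)$ is its Laplacian matrix ($A(G)$ the adjacency matrix, $D(G)$ the diagonal degree matrix), with eigenvalues $0 = \lambda_1(G) \leq \lambda_2(G) \leq \cdots \leq \lambda_n(G)$. The algebraic connectivity is $\lambda(G) := \lambda_2(G)$. The paper states the result as $\max\{\lambda(G), \lambda(\bar{G})\} \geq 1 - O(n^{-1/3})$. *)

theory Defs
  imports "Jordan_Normal_Form.Char_Poly"
begin

text \<open>A simple graph on the vertex set {0..<n} is given by a symmetric, irreflexive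
  edge relation E (values outside {0..<n} are irrelevant).\<close>

definition simple_graph_on :: "nat \<Rightarrow> (nat \<Rightarrow> nat \<Rightarrow> bool) \<Rightarrow> bool" where
  "simple_graph_on n E \<longleftrightarrow> (\<forall>i<n. \<forall>j<n. E i j \<longleftrightarrow> E j i) \<and> (\<forall>i<n. \<not> E i i)"

definition graph_complement :: "(nat \<Rightarrow> nat \<Rightarrow> bool) \<Rightarrow> nat \<Rightarrow> nat \<Rightarrow> bool" where
  "graph_complement E i j \<longleftrightarrow> i \<noteq> j \<and> \<not> E i j"

definition degree_in :: "nat \<Rightarrow> (nat \<Rightarrow> nat \<Rightarrow> bool) \<Rightarrow> nat \<Rightarrow> nat" where
  "degree_in n E i = card {k. k < n \<and> E i k}"

definition laplacian :: "nat \<Rightarrow> (nat \<Rightarrow> nat \<Rightarrow> bool) \<Rightarrow> real mat" where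
  "laplacian n E = mat n n (\<lambda>(i,j).
     (if i = j then real (degree_in n E i) else 0) - (if E i j then 1 else 0))"

definition eigenvalues_sorted :: "real mat \<Rightarrow> real list" where
  "eigenvalues_sorted A = sorted_list_of_multiset
     (THE M. size M = dim_row A \<and> char_poly A = prod_mset (image_mset (\<lambda>a. [:-a, 1:]) M))"

text \<open>Algebraic connectivity lambda_2(G) (index 1 in 0-based list).\<close>
definition algebraic_connectivity :: "nat \<Rightarrow> (nat \<Rightarrow> nat \<Rightarrow> bool) \<Rightarrow> real" where
  "algebraic_connectivity n E = eigenvalues_sorted (laplacian n E) ! 1"

end

theory Submission
  imports Defs "Jordan_Normal_Form.Schur_Decomposition"
begin

text \<open>
  Suppose both connectivities are below 1 - C q^2, where q = n^(-1/6), and take unit test vectors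
  x for G and y for its complement, translated so that their medians are 0. Each pair i, k is an
  edge of one of the two graphs, so min ((x i - x k)^2) ((y i - y k)^2) summed over all ordered
  pairs is at most 4. With the threshold s = 20 q^3 (of order n^(-1/2)) this budget shows that x is
  tiny where \<bar>y\<bar> > s and vice versa, that x and y cannot both have mass more than q^2 on
  entries of size at most s, and that for one of them, say y, the mass below s is at most q^2 and
  the sum of \<bar>y j\<bar> over \<bar>y j\<bar> > s is O(1/q).

  If every j with \<bar>y j\<bar> > s has a non-neighbour in S = {i. \<bar>y i\<bar> \<le> s}, these
  non-edges alone give y the energy 1 - O(q^2) in the complement. Otherwise some such j is joined in
  G to all of S, and the star from j to S gives x the energy 1 - O(q^2) in G.
\<close>

subsection \<open>Rayleigh quotients and the second eigenvalue\<close>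

text \<open>Over the complex numbers every root \<open>a\<close> has an eigenvector
  \<open>v\<close>, and symmetry makes the Hermitian form at \<open>v\<close> real. That form is
  \<open>a * S\<close> with \<open>S\<close> the squared norm of \<open>v\<close>, so
  \<open>a\<close> is real. The real factorisation follows because the embedding of real into
  complex polynomials is injective.\<close>

lemma symmetric_real_char_poly_splits:
  fixes A :: "real mat"
  assumes A: "A \<in> carrier_mat n n" and sym: "\<And>i j. i < n \<Longrightarrow> j < n \<Longrightarrow> A $$ (i, j) = A $$ (j, i)"
  shows "\<exists>es. char_poly A = (\<Prod>a\<leftarrow>es. [:- a, 1:]) \<and> length es = n"
proof -
  let ?A = "map_mat complex_of_real A"
  have cA: "?A \<in> carrier_mat n n" using A by simp
  obtain as where as: "char_poly ?A = (\<Prod>a\<leftarrow>as. [:- a, 1:])" "length as = n"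
    using char_poly_factorized[OF cA] by blast
  have real: "a \<in> \<real>" if "a \<in> set as" for a
  proof -
    have "poly (char_poly ?A) a = 0"
      using that by (auto simp: as poly_prod_list prod_list_zero_iff)
    then obtain v where v: "v \<in> carrier_vec n" "v \<noteq> 0\<^sub>v n" "?A *\<^sub>v v = a \<cdot>\<^sub>v v"
      using eigenvalue_root_char_poly[OF cA] cA unfolding eigenvalue_def eigenvector_def by auto
    define S where "S = (\<Sum>i<n. cnj (v $ i) * v $ i)"
    have row: "(\<Sum>j<n. A $$ (i, j) * v $ j) = a * v $ i" if i: "i < n" for i
    proof -
      have "(?A *\<^sub>v v) $ i = (\<Sum>j<n. A $$ (i, j) * v $ j)"
        using A v(1) i by (simp add: scalar_prod_def lessThan_atLeast0)
      then show ?thesis using v i by simp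
    qed
    have "(\<Sum>i<n. \<Sum>j<n. cnj (v $ i) * (A $$ (i, j) * v $ j)) = (\<Sum>i<n. a * (cnj (v $ i) * v $ i))"
      by (intro sum.cong refl) (simp add: row sum_distrib_left[symmetric] mult.left_commute)
    then have H: "(\<Sum>i<n. \<Sum>j<n. cnj (v $ i) * (A $$ (i, j) * v $ j)) = a * S"
      by (simp add: S_def sum_distrib_left)
    have "cnj a * S = cnj (a * S)" by (simp add: S_def mult.commute)
    also have "\<dots> = (\<Sum>i<n. \<Sum>j<n. v $ i * (A $$ (i, j) * cnj (v $ j)))" by (simp flip: H)
    also have "\<dots> = (\<Sum>i<n. \<Sum>j<n. cnj (v $ i) * (A $$ (i, j) * v $ j))"
      by (subst sum.swap) (auto intro!: sum.cong simp: sym)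
    finally have "cnj a * S = a * S" using H by simp
    moreover have "S = complex_of_real (\<Sum>i<n. (cmod (v $ i))\<^sup>2)"
      unfolding S_def of_real_sum by (intro sum.cong refl) (subst complex_norm_square, rule mult.commute)
    moreover have "\<exists>i<n. v $ i \<noteq> 0" using v(1,2) by (metis carrier_vecD eq_vecI index_zero_vec)
    then have "(\<Sum>i<n. (cmod (v $ i))\<^sup>2) \<noteq> 0" by (subst sum_nonneg_eq_0_iff) auto
    ultimately have "cnj a = a" by (metis mult_cancel_right of_real_eq_0_iff)
    then show ?thesis by (simp add: Reals_cnj_iff)
  qed
  interpret map_poly_hom: map_poly_inj_idom_hom complex_of_real ..
  define es where "es = map Re as"
  have "map complex_of_real es = as"
    unfolding es_def map_map by (intro map_idI) (use real in \<open>auto simp: o_def\<close>)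
  then have "map_poly complex_of_real (\<Prod>a\<leftarrow>es. [:- a, 1:]) = (\<Prod>a\<leftarrow>as. [:- a, 1:])"
    by (auto simp: map_poly_hom.hom_prod_list o_def hom_distribs)
  also have "\<dots> = map_poly complex_of_real (char_poly A)"
    unfolding as(1)[symmetric] by (rule of_real_hom.char_poly_hom[OF A])
  finally have "char_poly A = (\<Prod>a\<leftarrow>es. [:- a, 1:])" by simp
  moreover have "length es = n" using as(2) by (simp add: es_def)
  ultimately show ?thesis by blast
qed

text \<open>A product of monic linear factors determines the multiset of its roots through
  \<open>proots\<close>, so the definite description in \<open>eigenvalues_sorted\<close> has
  exactly one solution.\<close>

lemma eigenvalues_sorted_eq:
  assumes A: "A \<in> carrier_mat n n" and cp: "char_poly A = (\<Prod>a\<leftarrow>es. [:- a, 1:])" and len: "length es = n"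
  shows "eigenvalues_sorted A = sort es"
proof -
  have "(THE M. size M = dim_row A \<and> char_poly A = prod_mset (image_mset (\<lambda>a. [:-a, 1:]) M)) = mset es"
  proof (rule the_equality)
    show "size (mset es) = dim_row A \<and> char_poly A = prod_mset (image_mset (\<lambda>a. [:-a, 1:]) (mset es))"
      using A cp len by (simp flip: mset_map prod_mset_prod_list)
  next
    fix M assume "size M = dim_row A \<and> char_poly A = prod_mset (image_mset (\<lambda>a. [:-a, 1:]) M)"
    then have "proots (prod_mset (image_mset (\<lambda>a. [:-a, 1:]) M)) = proots (\<Prod>a\<leftarrow>es. [:- a, 1:])" using cp by simp
    moreover have "proots (prod_mset (image_mset (\<lambda>a. [:-a, 1:]) M)) = M" for M :: "real multiset"
    proof (induction M)
      case (add x M)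
      have "(\<Prod>a\<in>#M. [:- a, 1:]) \<noteq> 0" by (auto simp: prod_mset_zero_iff)
      then have "proots ([:- x, 1:] * (\<Prod>a\<in>#M. [:- a, 1:])) = {#x#} + M"
        by (subst proots_mult) (use add in simp_all)
      then show ?case by simp
    qed simp
    moreover have "(\<Prod>a\<leftarrow>es. [:- a, 1:]) = prod_mset (image_mset (\<lambda>a. [:-a, 1:]) (mset es))"
      by (simp flip: mset_map prod_mset_prod_list)
    ultimately show "M = mset es" by simp
  qed
  then show ?thesis unfolding eigenvalues_sorted_def by (simp add: sorted_list_of_multiset_mset)
qed

text \<open>Here \<open>p\<close>, \<open>c\<close>, \<open>r\<close> stand for the Gram entries of
  vectors u0, u1 with A u0 = a u0 and A u1 = b u0 + e u1, and the last assumption is the symmetry of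
  A. The right side exceeds the left by
  \<open>(e - a) * (\<alpha> * p + \<beta> * c)\<^sup>2 / p\<close>.\<close>

lemma rayleigh_plane_le:
  fixes a b c e p r :: real
  assumes "0 < p" "a \<le> e" and b: "b * p + e * c = a * c"
  shows "\<alpha> * \<alpha> * (a * p) + \<alpha> * \<beta> * (b * p + e * c) + \<beta> * \<alpha> * (a * c) + \<beta> * \<beta> * (b * c + e * r)
    \<le> e * (\<alpha> * \<alpha> * p + 2 * (\<alpha> * \<beta> * c) + \<beta> * \<beta> * r)"
proof -
  have bc: "b = (a - e) * c / p" using assms by (simp add: field_simps)
  have "e * (\<alpha> * \<alpha> * p + 2 * (\<alpha> * \<beta> * c) + \<beta> * \<beta> * r)
      - (\<alpha> * \<alpha> * (a * p) + \<alpha> * \<beta> * (b * p + e * c) + \<beta> * \<alpha> * (a * c) + \<beta> * \<beta> * (b * c + e * r))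
      = (e - a) * (\<alpha> * p + \<beta> * c)\<^sup>2 / p"
    unfolding b unfolding bc using \<open>0 < p\<close> by (simp add: field_simps power2_eq_square)
  moreover have "0 \<le> (e - a) * (\<alpha> * p + \<beta> * c)\<^sup>2 / p" using assms by simp
  ultimately show ?thesis by linarith
qed

text \<open>Schur triangularisation with the eigenvalues listed in increasing order makes the span of the
  first two basis vectors invariant; a plane always meets the hyperplane orthogonal to w.\<close>
lemma second_eigenvalue_test_vector:
  fixes A :: "real mat"
  assumes A: "A \<in> carrier_mat n n" and sym: "A\<^sup>T = A"
    and cp: "char_poly A = (\<Prod>a\<leftarrow>es. [:- a, 1:])" and n: "n \<ge> 2" and le: "es ! 0 \<le> es ! 1"
    and w: "w \<in> carrier_vec n"
  shows "\<exists>z \<in> carrier_vec n. z \<noteq> 0\<^sub>v n \<and> w \<bullet> z = 0 \<and> z \<bullet> (A *\<^sub>v z) \<le> es ! 1 * (z \<bullet> z)"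
proof -
  obtain B P Q where "schur_decomposition A es = (B, P, Q)" by (metis prod_cases3)
  from schur_decomposition[OF A cp this]
  have sw: "similar_mat_wit A B P Q" and ut: "upper_triangular B" and dg: "diag_mat B = es" by auto
  from sw A have car: "B \<in> carrier_mat n n" "P \<in> carrier_mat n n" "Q \<in> carrier_mat n n"
    and QP: "Q * P = 1\<^sub>m n" and APB: "A = P * B * Q"
    unfolding similar_mat_wit_def Let_def by auto
  have AP: "A * P = P * B"
  proof -
    have "A * P = P * B * (Q * P)" unfolding APB using car by (simp add: assoc_mult_mat[of _ n n _ n _ n])
    then show ?thesis using car by (simp add: QP)
  qed
  define u0 u1 where "u0 = col P 0" and "u1 = col P 1"
  have u: "u0 \<in> carrier_vec n" "u1 \<in> carrier_vec n" using car n by (auto simp: u0_def u1_def)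
  define b where "b = B $$ (0, 1)"
  have d0: "B $$ (0, 0) = es ! 0" and d1: "B $$ (1, 1) = es ! 1"
    using dg car n by (auto simp: diag_mat_def nth_append)
  have colPB: "A *\<^sub>v col P j = P *\<^sub>v col B j" if "j < n" for j
    using AP that car A by (metis col_mult2)
  have B0: "col B 0 = es ! 0 \<cdot>\<^sub>v unit_vec n 0"
  proof (rule eq_vecI)
    fix i assume "i < dim_vec (es ! 0 \<cdot>\<^sub>v unit_vec n 0)"
    then show "col B 0 $ i = (es ! 0 \<cdot>\<^sub>v unit_vec n 0) $ i"
      using car n d0 upper_triangularD[OF ut, of 0 i] by (cases "i = 0") auto
  qed (use car in auto)
  have B1: "col B 1 = b \<cdot>\<^sub>v unit_vec n 0 + es ! 1 \<cdot>\<^sub>v unit_vec n 1"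
  proof (rule eq_vecI)
    fix i assume "i < dim_vec (b \<cdot>\<^sub>v unit_vec n 0 + es ! 1 \<cdot>\<^sub>v unit_vec n 1)"
    then show "col B 1 $ i = (b \<cdot>\<^sub>v unit_vec n 0 + es ! 1 \<cdot>\<^sub>v unit_vec n 1) $ i"
      using car n d1 upper_triangularD[OF ut, of 1 i] by (cases "i = 0"; cases "i = 1") (auto simp: b_def)
  qed (use car in auto)
  have Pe: "P *\<^sub>v unit_vec n j = col P j" if "j < n" for j
    using car that by (intro eq_vecI) auto
  have Au0: "A *\<^sub>v u0 = es ! 0 \<cdot>\<^sub>v u0"
    using colPB[of 0] n car by (simp add: u0_def B0 mult_mat_vec[of P n n] Pe)
  have Au1: "A *\<^sub>v u1 = b \<cdot>\<^sub>v u0 + es ! 1 \<cdot>\<^sub>v u1"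
    using colPB[of 1] n car
    by (simp add: u0_def u1_def B1[unfolded One_nat_def] mult_mat_vec[of P n n] Pe mult_add_distrib_mat_vec[of P n n])
  obtain \<alpha> \<beta> where ab: "\<alpha> \<noteq> 0 \<or> \<beta> \<noteq> 0" "\<alpha> * (w \<bullet> u0) + \<beta> * (w \<bullet> u1) = 0"
  proof (cases "w \<bullet> u0 = 0")
    case True
    then show ?thesis using that[of 1 0] by simp
  next
    case False
    then show ?thesis using that[of "w \<bullet> u1" "- (w \<bullet> u0)"] by simp
  qed
  define z where "z = \<alpha> \<cdot>\<^sub>v u0 + \<beta> \<cdot>\<^sub>v u1"
  have z: "z \<in> carrier_vec n" using u by (simp add: z_def)
  \<comment> \<open>The two columns are linearly independent because \<open>Q\<close> is a left
    inverse of \<open>P\<close>.\<close>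
  have z_neq: "\<alpha>' \<cdot>\<^sub>v u0 + \<beta>' \<cdot>\<^sub>v u1 \<noteq> 0\<^sub>v n" if "\<alpha>' \<noteq> 0 \<or> \<beta>' \<noteq> 0" for \<alpha>' \<beta>'
  proof
    assume eq: "\<alpha>' \<cdot>\<^sub>v u0 + \<beta>' \<cdot>\<^sub>v u1 = 0\<^sub>v n"
    let ?w = "\<alpha>' \<cdot>\<^sub>v unit_vec n 0 + \<beta>' \<cdot>\<^sub>v unit_vec n 1 :: real vec"
    have w': "?w \<in> carrier_vec n" by simp
    have "P *\<^sub>v ?w = 0\<^sub>v n"
      using eq n car by (simp add: u0_def u1_def mult_mat_vec[of P n n] Pe mult_add_distrib_mat_vec[of P n n])
    then have "Q *\<^sub>v (P *\<^sub>v ?w) = 0\<^sub>v n" using car by (auto simp: scalar_prod_def intro!: eq_vecI)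
    then have "?w = 0\<^sub>v n" using assoc_mult_mat_vec[OF car(3,2) w'] w' by (simp add: QP)
    then have "?w $ 0 = 0" "?w $ 1 = 0" using n by auto
    then show False using that n by auto
  qed
  have "u0 \<noteq> 0\<^sub>v n" using z_neq[of 1 0] u by auto
  then have p: "0 < u0 \<bullet> u0"
    using u conjugate_square_greater_0_vec[OF u(1)] by (simp add: conjugate_vec_def vec_eq_iff)
  have comm: "u1 \<bullet> u0 = u0 \<bullet> u1" using comm_scalar_prod u by blast
  \<comment> \<open>The columns of \<open>P\<close> are not assumed orthogonal; the symmetry of
    \<open>A\<close> ties \<open>b\<close> to their inner product instead.\<close>
  have "u0 \<bullet> (A *\<^sub>v u1) = (A *\<^sub>v u0) \<bullet> u1"
    using transpose_vec_mult_scalar[OF A u(2) u(1)] sym by simp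
  then have key: "b * (u0 \<bullet> u0) + es ! 1 * (u0 \<bullet> u1) = es ! 0 * (u0 \<bullet> u1)"
    using u unfolding Au0 Au1 by (simp add: scalar_prod_add_distrib[of _ n])
  have Az: "A *\<^sub>v z = \<alpha> \<cdot>\<^sub>v (es ! 0 \<cdot>\<^sub>v u0) + \<beta> \<cdot>\<^sub>v (b \<cdot>\<^sub>v u0 + es ! 1 \<cdot>\<^sub>v u1)"
    unfolding z_def using A u
    by (simp add: mult_add_distrib_mat_vec[of A n n] mult_mat_vec[of A n n] Au0 Au1)
  have "z \<bullet> (A *\<^sub>v z) = \<alpha> * \<alpha> * (es ! 0 * (u0 \<bullet> u0)) + \<alpha> * \<beta> * (b * (u0 \<bullet> u0) + es ! 1 * (u0 \<bullet> u1))
      + \<beta> * \<alpha> * (es ! 0 * (u0 \<bullet> u1)) + \<beta> * \<beta> * (b * (u0 \<bullet> u1) + es ! 1 * (u1 \<bullet> u1))"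
    unfolding Az unfolding z_def using u
    by (simp add: scalar_prod_add_distrib[of _ n] add_scalar_prod_distrib[of _ n] comm algebra_simps)
  also have "\<dots> \<le> es ! 1 * (\<alpha> * \<alpha> * (u0 \<bullet> u0) + 2 * (\<alpha> * \<beta> * (u0 \<bullet> u1)) + \<beta> * \<beta> * (u1 \<bullet> u1))"
    by (rule rayleigh_plane_le[OF p le key])
  also have "\<dots> = es ! 1 * (z \<bullet> z)"
    unfolding z_def using u
    by (simp add: scalar_prod_add_distrib[of _ n] add_scalar_prod_distrib[of _ n] comm algebra_simps)
  finally have "z \<bullet> (A *\<^sub>v z) \<le> es ! 1 * (z \<bullet> z)" .
  moreover have "w \<bullet> z = 0"
    using ab(2) u w by (simp add: z_def scalar_prod_add_distrib[of _ n])
  moreover have "z \<noteq> 0\<^sub>v n" unfolding z_def by (rule z_neq[OF ab(1)])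
  ultimately show ?thesis using z by blast
qed

lemma laplacian_quadratic_form:
  assumes sym: "\<And>i k. i < n \<Longrightarrow> k < n \<Longrightarrow> E i k = E k i" and z: "z \<in> carrier_vec n"
  shows "2 * (z \<bullet> (laplacian n E *\<^sub>v z)) = (\<Sum>i<n. \<Sum>k<n. if E i k then (z $ i - z $ k)\<^sup>2 else 0)"
proof -
  have row: "(laplacian n E *\<^sub>v z) $ i = (\<Sum>k<n. if E i k then z $ i - z $ k else 0)" if "i < n" for i
  proof -
    have "(laplacian n E *\<^sub>v z) $ i =
        (\<Sum>k<n. ((if i = k then real (degree_in n E i) else 0) - (if E i k then 1 else 0)) * z $ k)"
      using that z by (simp add: laplacian_def scalar_prod_def lessThan_atLeast0)
    also have "\<dots> = (\<Sum>k<n. if i = k then real (degree_in n E i) * z $ k else 0) - (\<Sum>k<n. if E i k then z $ k else 0)"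
      unfolding sum_subtractf[symmetric] by (intro sum.cong) (auto simp: algebra_simps)
    also have "(\<Sum>k<n. if i = k then real (degree_in n E i) * z $ k else 0) = real (degree_in n E i) * z $ i"
      using that by simp
    also have "\<dots> = (\<Sum>k<n. if E i k then z $ i else 0)"
      by (simp add: degree_in_def sum.If_cases Collect_conj_eq lessThan_def)
    finally show ?thesis by (simp add: sum_subtractf[symmetric] if_distrib[of "\<lambda>t. _ - t"] cong: if_cong)
  qed
  let ?S = "\<Sum>i<n. \<Sum>k<n. if E i k then z $ i * (z $ i - z $ k) else 0"
  have S: "z \<bullet> (laplacian n E *\<^sub>v z) = ?S"
    unfolding scalar_prod_def by (auto simp: laplacian_def lessThan_atLeast0 row[unfolded laplacian_def lessThan_atLeast0]
        sum_distrib_left intro!: sum.cong simp del: index_mult_mat_vec)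
  \<comment> \<open>Exchanging the names of the endpoints and adding both forms completes the
    square.\<close>
  have "?S = (\<Sum>i<n. \<Sum>k<n. if E i k then z $ k * (z $ k - z $ i) else 0)"
    by (subst sum.swap) (auto intro!: sum.cong simp: sym)
  then have "2 * ?S = (\<Sum>i<n. \<Sum>k<n. (if E i k then z $ i * (z $ i - z $ k) else 0) + (if E i k then z $ k * (z $ k - z $ i) else 0))"
    by (simp add: sum.distrib)
  also have "\<dots> = (\<Sum>i<n. \<Sum>k<n. if E i k then (z $ i - z $ k)\<^sup>2 else 0)"
    by (intro sum.cong refl) (simp add: power2_eq_square algebra_simps)
  finally show ?thesis using S by simp
qed

subsection \<open>Two test vectors sharing a small energy budget\<close>

text \<open>Take for \<open>c\<close> the largest attained value that at least half of the entries
  reach. Were fewer than half of the entries at most \<open>c\<close>, the next larger value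
  \<open>v\<close> would qualify as well.\<close>

lemma median_exists:
  fixes x :: "nat \<Rightarrow> real"
  assumes "n \<ge> 1"
  obtains c where "n \<le> 2 * card {i. i < n \<and> c \<le> x i}" "n \<le> 2 * card {i. i < n \<and> x i \<le> c}"
proof -
  define S where "S = {v \<in> x ` {..<n}. n \<le> 2 * card {i. i < n \<and> v \<le> x i}}"
  define c where "c = Max S"
  have ne: "x ` {..<n} \<noteq> {}" using assms by (auto simp: lessThan_empty_iff)
  have "{i. i < n \<and> Min (x ` {..<n}) \<le> x i} = {..<n}" by auto
  then have "Min (x ` {..<n}) \<in> S" using ne unfolding S_def by simp
  then have cS: "c \<in> S" unfolding c_def by (intro Max_in) (auto simp: S_def)
  have "n \<le> 2 * card {i. i < n \<and> x i \<le> c}"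
  proof (rule ccontr)
    assume small: "\<not> ?thesis"
    define T where "T = {i. i < n \<and> c < x i}"
    define v where "v = Min (x ` T)"
    have "card ({i. i < n \<and> x i \<le> c} \<union> T) = card {i. i < n \<and> x i \<le> c} + card T"
      by (rule card_Un_disjoint) (auto simp: T_def)
    moreover have "{i. i < n \<and> x i \<le> c} \<union> T = {..<n}" by (auto simp: T_def)
    ultimately have cT: "card {i. i < n \<and> x i \<le> c} + card T = n" by simp
    then have "T \<noteq> {}" using small by auto
    moreover have fT: "finite T" by (auto simp: T_def)
    ultimately have v: "v \<in> x ` T" "\<And>i. i \<in> T \<Longrightarrow> v \<le> x i" unfolding v_def by auto
    have "T \<subseteq> {i. i < n \<and> v \<le> x i}" using v by (auto simp: T_def)
    then have "card T \<le> card {i. i < n \<and> v \<le> x i}" by (intro card_mono) auto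
    then have "v \<in> S" using v cT small unfolding S_def by (auto simp: T_def)
    then have "v \<le> c" unfolding c_def by (intro Max_ge) (auto simp: S_def)
    then show False using v(1) by (auto simp: T_def)
  qed
  then show ?thesis using cS that unfolding S_def by auto
qed

text \<open>At least N/4 points of \<open>T\<close> lie on the other side of 0 from
  \<open>u\<close>, hence at distance at least \<bar>u\<bar> from it, so N u^2 is at most 4 times
  the shifted sum. With x^2 \<le> 2 (x - u)^2 + 2 u^2 the factor becomes 2 + 8 = 10.\<close>

lemma sum_sq_shift_ge:
  fixes x :: "'a \<Rightarrow> real"
  assumes "finite T" "real (card T) \<le> N"
    and neg: "N \<le> 4 * real (card {i \<in> T. x i \<le> 0})" and pos: "N \<le> 4 * real (card {i \<in> T. 0 \<le> x i})"
  shows "(\<Sum>i\<in>T. (x i)\<^sup>2) \<le> 10 * (\<Sum>i\<in>T. (x i - u)\<^sup>2)"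
proof -
  let ?Q = "\<Sum>i\<in>T. (x i - u)\<^sup>2"
  have "\<exists>S \<subseteq> T. N \<le> 4 * real (card S) \<and> (\<forall>i\<in>S. u\<^sup>2 \<le> (x i - u)\<^sup>2)"
  proof (cases "u \<ge> 0")
    case True
    have "u\<^sup>2 \<le> (x i - u)\<^sup>2" if "x i \<le> 0" for i
      using True that by (intro abs_le_square_iff[THEN iffD1]) auto
    then show ?thesis using neg by (intro exI[of _ "{i \<in> T. x i \<le> 0}"]) auto
  next
    case False
    have "u\<^sup>2 \<le> (x i - u)\<^sup>2" if "x i \<ge> 0" for i
      using False that by (intro abs_le_square_iff[THEN iffD1]) auto
    then show ?thesis using pos by (intro exI[of _ "{i \<in> T. 0 \<le> x i}"]) auto
  qed
  then obtain S where S: "S \<subseteq> T" "N \<le> 4 * real (card S)" "\<And>i. i \<in> S \<Longrightarrow> u\<^sup>2 \<le> (x i - u)\<^sup>2" by auto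
  have "real (card S) * u\<^sup>2 \<le> (\<Sum>i\<in>S. (x i - u)\<^sup>2)" using S(3) sum_mono[of S "\<lambda>_. u\<^sup>2"] by simp
  also have "\<dots> \<le> ?Q" using S(1) assms(1) by (intro sum_mono2) auto
  finally have "N * u\<^sup>2 \<le> 4 * ?Q"
    using mult_right_mono[OF S(2), of "u\<^sup>2"] by (simp add: algebra_simps)
  moreover have "real (card T) * u\<^sup>2 \<le> N * u\<^sup>2" by (intro mult_right_mono assms) auto
  moreover have "(\<Sum>i\<in>T. (x i)\<^sup>2) \<le> (\<Sum>i\<in>T. 2 * (x i - u)\<^sup>2 + 2 * u\<^sup>2)"
  proof (rule sum_mono)
    fix i
    have "0 \<le> (x i - u - u)\<^sup>2" by simp
    then show "(x i)\<^sup>2 \<le> 2 * (x i - u)\<^sup>2 + 2 * u\<^sup>2" by (simp add: power2_eq_square algebra_simps)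
  qed
  moreover have "\<dots> = 2 * ?Q + 2 * (real (card T) * u\<^sup>2)"
    by (simp add: sum.distrib sum_distrib_left algebra_simps)
  ultimately show ?thesis by linarith
qed

text \<open>For centred f and g the expansion of the right-hand side only has the terms
  2 card T (sum f^2 g^2) + 2 (sum f^2)(sum g^2) + 4 (sum f g)^2.\<close>
lemma sum_sq_diff_prod_ge:
  fixes x y :: "'a \<Rightarrow> real"
  assumes "finite T" "0 \<le> a" "0 \<le> b"
    and a: "\<And>u. a \<le> (\<Sum>i\<in>T. (x i - u)\<^sup>2)" and b: "\<And>u. b \<le> (\<Sum>i\<in>T. (y i - u)\<^sup>2)"
  shows "2 * (a * b) \<le> (\<Sum>i\<in>T. \<Sum>k\<in>T. (x i - x k)\<^sup>2 * (y i - y k)\<^sup>2)"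
proof (cases "T = {}")
  case True
  then show ?thesis using a[of 0] assms(2) by auto
next
  case False
  define u v where "u = (\<Sum>i\<in>T. x i) / card T" and "v = (\<Sum>i\<in>T. y i) / card T"
  define f g where "f = (\<lambda>i. x i - u)" and "g = (\<lambda>i. y i - v)"
  have sf: "sum f T = 0" and sg: "sum g T = 0"
    using False assms(1) by (simp_all add: f_def g_def u_def v_def sum_subtractf)
  have exp: "(x i - x k)\<^sup>2 * (y i - y k)\<^sup>2 =
     (f i)\<^sup>2 * (g i)\<^sup>2 - 2 * ((f i)\<^sup>2 * g i * g k) + (f i)\<^sup>2 * (g k)\<^sup>2
     - 2 * (f i * (g i)\<^sup>2 * f k) + 4 * ((f i * g i) * (f k * g k)) - 2 * (f i * (f k * (g k)\<^sup>2))
     + (g i)\<^sup>2 * (f k)\<^sup>2 - 2 * (g i * ((f k)\<^sup>2 * g k)) + (f k)\<^sup>2 * (g k)\<^sup>2" for i k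
  proof -
    have "x i - x k = f i - f k" "y i - y k = g i - g k" by (simp_all add: f_def g_def)
    then show ?thesis by (simp only:) (simp add: power2_eq_square algebra_simps)
  qed
  have eq: "(\<Sum>i\<in>T. \<Sum>k\<in>T. (x i - x k)\<^sup>2 * (y i - y k)\<^sup>2) =
      2 * real (card T) * (\<Sum>i\<in>T. (f i)\<^sup>2 * (g i)\<^sup>2) + 2 * ((\<Sum>i\<in>T. (f i)\<^sup>2) * (\<Sum>i\<in>T. (g i)\<^sup>2))
      + 4 * (\<Sum>i\<in>T. f i * g i)\<^sup>2"
    unfolding exp
    by (simp only: sum.distrib sum_subtractf sum_distrib_left[symmetric] sum_distrib_right[symmetric] sf sg
        sum_constant) (simp add: power2_eq_square sum_distrib_left mult_ac)
  have "a * b \<le> (\<Sum>i\<in>T. (f i)\<^sup>2) * (\<Sum>i\<in>T. (g i)\<^sup>2)"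
    unfolding f_def g_def by (intro mult_mono a b assms order_trans[OF assms(2) a])
  moreover have "0 \<le> (\<Sum>i\<in>T. (f i)\<^sup>2 * (g i)\<^sup>2)" by (intro sum_nonneg) auto
  then have "0 \<le> 2 * real (card T) * (\<Sum>i\<in>T. (f i)\<^sup>2 * (g i)\<^sup>2)" by simp
  moreover have "0 \<le> 4 * (\<Sum>i\<in>T. f i * g i)\<^sup>2" by simp
  ultimately show ?thesis unfolding eq by linarith
qed

section \<open>Splitting the vertices by the size of their entries\<close>

definition large :: "nat \<Rightarrow> real \<Rightarrow> (nat \<Rightarrow> real) \<Rightarrow> nat set" where
  "large n t x = {i. i < n \<and> t < \<bar>x i\<bar>}"

definition small :: "nat \<Rightarrow> real \<Rightarrow> (nat \<Rightarrow> real) \<Rightarrow> nat set" where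
  "small n t x = {i. i < n \<and> \<bar>x i\<bar> \<le> t}"

lemma finite_large [simp]: "finite (large n t x)" and finite_small [simp]: "finite (small n t x)"
  by (simp_all add: large_def small_def)

lemma small_Un_large: "small n t x \<union> large n t x = {..<n}" and small_Int_large: "small n t x \<inter> large n t x = {}"
  by (auto simp: large_def small_def)

lemma sum_small_large: "(\<Sum>i\<in>small n t x. f i) + (\<Sum>i\<in>large n t x. f i) = (\<Sum>i<n. f i :: real)"
  using sum.union_disjoint[of "small n t x" "large n t x" f] by (simp add: small_Un_large small_Int_large)

text \<open>The rectangles I x J and J x I are disjoint and, by symmetry, have equal sums. This
  bounds an energy from below by the edges between two disjoint vertex sets.\<close>

lemma sum_disjoint_rectangle_le:
  fixes g :: "nat \<Rightarrow> nat \<Rightarrow> real"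
  assumes sym: "\<And>i k. i < n \<Longrightarrow> k < n \<Longrightarrow> g i k = g k i" and nonneg: "\<And>i k. 0 \<le> g i k"
    and IJ: "I \<subseteq> {..<n}" "J \<subseteq> {..<n}" "I \<inter> J = {}"
  shows "2 * (\<Sum>i\<in>I. \<Sum>k\<in>J. g i k) \<le> (\<Sum>i<n. \<Sum>k<n. g i k)"
proof -
  have fin: "finite I" "finite J" using IJ finite_subset by blast+
  have "(\<Sum>i\<in>I. \<Sum>k\<in>J. g i k) = (\<Sum>k\<in>J. \<Sum>i\<in>I. g i k)" by (rule sum.swap)
  also have "\<dots> = (\<Sum>i\<in>J. \<Sum>k\<in>I. g i k)" using IJ by (intro sum.cong sym) auto
  finally have "2 * (\<Sum>i\<in>I. \<Sum>k\<in>J. g i k) = (\<Sum>i\<in>I. \<Sum>k\<in>J. g i k) + (\<Sum>i\<in>J. \<Sum>k\<in>I. g i k)" by simp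
  also have "\<dots> \<le> (\<Sum>i\<in>I. \<Sum>k<n. g i k) + (\<Sum>i\<in>J. \<Sum>k<n. g i k)"
    using IJ nonneg by (intro add_mono sum_mono sum_mono2) auto
  also have "\<dots> = (\<Sum>i\<in>I \<union> J. \<Sum>k<n. g i k)" using fin IJ by (simp add: sum.union_disjoint)
  also have "\<dots> \<le> (\<Sum>i<n. \<Sum>k<n. g i k)"
    using IJ nonneg by (intro sum_mono2 sum_nonneg) auto
  finally show ?thesis .
qed

lemma card_large_sq_le:
  fixes x :: "nat \<Rightarrow> real"
  assumes "t > 0"
  shows "real (card (large n t x)) * t\<^sup>2 \<le> (\<Sum>i<n. (x i)\<^sup>2)"
proof -
  have "real (card (large n t x)) * t\<^sup>2 = (\<Sum>i\<in>large n t x. t\<^sup>2)" by simp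
  also have "\<dots> \<le> (\<Sum>i\<in>large n t x. (x i)\<^sup>2)"
    using assms by (intro sum_mono abs_le_square_iff[THEN iffD1]) (auto simp: large_def)
  also have "\<dots> \<le> (\<Sum>i<n. (x i)\<^sup>2)" by (intro sum_mono2) (auto simp: large_def)
  finally show ?thesis .
qed

text \<open>E and F play symmetric roles. The sums over ordered pairs count every edge twice, whence the
  factor 2 in the last two assumptions; x and y are normalised to variance 1 and median 0.\<close>
locale centred_pair =
  fixes n :: nat and q :: real and E F :: "nat \<Rightarrow> nat \<Rightarrow> bool" and x y :: "nat \<Rightarrow> real"
  assumes q_pos: "0 < q" and nq: "real n * q ^ 6 = 1" and q_small: "2000000 * q\<^sup>2 < 1"
    and E_sym: "\<And>i k. i < n \<Longrightarrow> k < n \<Longrightarrow> E i k \<Longrightarrow> E k i"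
    and F_sym: "\<And>i k. i < n \<Longrightarrow> k < n \<Longrightarrow> F i k \<Longrightarrow> F k i"
    and cover: "\<And>i k. i < n \<Longrightarrow> k < n \<Longrightarrow> i \<noteq> k \<Longrightarrow> E i k \<or> F i k"
    and x_ge: "\<And>u. 1 \<le> (\<Sum>i<n. (x i - u)\<^sup>2)" and y_ge: "\<And>u. 1 \<le> (\<Sum>i<n. (y i - u)\<^sup>2)"
    and x_le: "(\<Sum>i<n. (x i)\<^sup>2) \<le> 3" and y_le: "(\<Sum>i<n. (y i)\<^sup>2) \<le> 3"
    and x_pos: "n \<le> 2 * card {i. i < n \<and> 0 \<le> x i}" and x_neg: "n \<le> 2 * card {i. i < n \<and> x i \<le> 0}"
    and y_pos: "n \<le> 2 * card {i. i < n \<and> 0 \<le> y i}" and y_neg: "n \<le> 2 * card {i. i < n \<and> y i \<le> 0}"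
    and QE: "(\<Sum>i<n. \<Sum>k<n. if E i k then (x i - x k)\<^sup>2 else 0) < 2 * (1 - 2000000 * q\<^sup>2)"
    and QF: "(\<Sum>i<n. \<Sum>k<n. if F i k then (y i - y k)\<^sup>2 else 0) < 2 * (1 - 2000000 * q\<^sup>2)"
begin

text \<open>Through the interpretations \<open>sw\<close>, every lemma proved for one ordering of
  the test vectors becomes available for the other.\<close>

lemma swap: "centred_pair n q F E y x"
  using q_pos nq q_small E_sym F_sym cover x_ge y_ge x_le y_le x_pos x_neg y_pos y_neg QE QF
  by unfold_locales blast+

lemma n_pos: "0 < real n" using nq q_pos by (cases "n = 0") auto

lemma divide_n: "c / real n = c * q ^ 6" using nq n_pos by (simp add: field_simps)

text \<open>A pair pays at least this amount whichever graph contains it, so estimates in terms of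
  it need no knowledge of the edges.\<close>

definition min_sq :: "nat \<Rightarrow> nat \<Rightarrow> real" where "min_sq i k = min ((x i - x k)\<^sup>2) ((y i - y k)\<^sup>2)"

lemma min_sq_nonneg: "0 \<le> min_sq i k" by (simp add: min_sq_def)

lemma sum_min_sq_le: "(\<Sum>i<n. \<Sum>k<n. min_sq i k) \<le> 4"
proof -
  have "(\<Sum>i<n. \<Sum>k<n. min_sq i k) \<le> (\<Sum>i<n. \<Sum>k<n. (if E i k then (x i - x k)\<^sup>2 else 0) + (if F i k then (y i - y k)\<^sup>2 else 0))"
  proof (intro sum_mono)
    fix i k assume "i \<in> {..<n}" "k \<in> {..<n}"
    then show "min_sq i k \<le> (if E i k then (x i - x k)\<^sup>2 else 0) + (if F i k then (y i - y k)\<^sup>2 else 0)"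
      using cover[of i k] by (cases "i = k") (auto simp: min_sq_def intro!: min.coboundedI1)
  qed
  also have "\<dots> \<le> 4" using QE QF by (simp add: sum.distrib) (smt (verit) zero_le_power2)
  finally show ?thesis .
qed

lemma sum_min_sq_subset_le:
  assumes "I \<subseteq> {..<n}" "\<And>i. i \<in> I \<Longrightarrow> K i \<subseteq> {..<n}"
  shows "(\<Sum>i\<in>I. \<Sum>k\<in>K i. min_sq i k) \<le> 4"
proof -
  have "(\<Sum>i\<in>I. \<Sum>k\<in>K i. min_sq i k) \<le> (\<Sum>i\<in>I. \<Sum>k<n. min_sq i k)"
    using assms by (intro sum_mono sum_mono2) (auto simp: min_sq_nonneg)
  also have "\<dots> \<le> (\<Sum>i<n. \<Sum>k<n. min_sq i k)"
    using assms by (intro sum_mono2 sum_nonneg) (auto simp: min_sq_nonneg)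
  finally show ?thesis using sum_min_sq_le by simp
qed

text \<open>For \<bar>y i\<bar> > t, at least a quarter of all k satisfy both \<bar>y k\<bar> \<le>
  t/2 and \<bar>x i - x k\<bar> \<ge> \<bar>x i\<bar>, the latter because 0 is a median of
  \<open>x\<close>. Each such pair costs at least min ((x i)^2) (t^2/4), and the budget 4 limits the
  sum of these minima to 16/n.\<close>

lemma large_y_sum_x_le:
  assumes "t > 0" "100 \<le> real n * t\<^sup>2"
  shows "(\<Sum>i\<in>large n t y. (x i)\<^sup>2) \<le> 16 / n"
proof -
  define B where "B = large n t y"
  define K where "K i = {k. k < n \<and> \<bar>y k\<bar> \<le> t / 2 \<and> \<bar>x i\<bar> \<le> \<bar>x i - x k\<bar>}" for i
  have cardK: "real n \<le> 4 * real (card (K i))" for i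
  proof -
    let ?S = "{k. k < n \<and> \<bar>x i\<bar> \<le> \<bar>x i - x k\<bar>}" and ?R = "large n (t / 2) y"
    have "n \<le> 2 * card ?S"
    proof (cases "x i \<ge> 0")
      case True
      then have "card {k. k < n \<and> x k \<le> 0} \<le> card ?S" by (intro card_mono) auto
      then show ?thesis using x_neg by linarith
    next
      case False
      then have "card {k. k < n \<and> 0 \<le> x k} \<le> card ?S" by (intro card_mono) auto
      then show ?thesis using x_pos by linarith
    qed
    moreover have "card ?S \<le> card (K i \<union> ?R)" by (intro card_mono) (auto simp: K_def large_def)
    moreover have "card (K i \<union> ?R) \<le> card (K i) + card ?R" by (rule card_Un_le)
    \<comment> \<open>Chebyshev gives card ?R * t^2 \<le> 12, and 8 * 12 = 96 is below the assumed
      100.\<close>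
    moreover have "real (card ?R) * 8 \<le> real n"
    proof -
      have "real (card ?R) * (t / 2)\<^sup>2 \<le> 3"
        using card_large_sq_le[of "t / 2" n y] y_le assms by linarith
      then have "real (card ?R) * t\<^sup>2 \<le> 12" by (simp add: power2_eq_square)
      then have "(real (card ?R) * 8) * t\<^sup>2 \<le> real n * t\<^sup>2" using assms by linarith
      then show ?thesis using assms by (simp add: mult_le_cancel_right)
    qed
    ultimately show ?thesis by linarith
  qed
  have fB: "finite B" by (simp add: B_def)
  have min_sq_ge: "min ((x i)\<^sup>2) (t\<^sup>2 / 4) \<le> min_sq i k" if "i \<in> B" "k \<in> K i" for i k
  proof -
    have "(x i)\<^sup>2 \<le> (x i - x k)\<^sup>2" using that by (intro abs_le_square_iff[THEN iffD1]) (auto simp: K_def)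
    moreover have "t / 2 \<le> \<bar>y i - y k\<bar>"
      using that abs_triangle_ineq2[of "y i" "y k"] by (simp add: K_def B_def large_def)
    then have "(t / 2)\<^sup>2 \<le> (y i - y k)\<^sup>2"
      using assms by (intro abs_le_square_iff[THEN iffD1]) auto
    ultimately show ?thesis by (auto simp: min_sq_def power_divide)
  qed
  have "n / 4 * (\<Sum>i\<in>B. min ((x i)\<^sup>2) (t\<^sup>2 / 4)) = (\<Sum>i\<in>B. n / 4 * min ((x i)\<^sup>2) (t\<^sup>2 / 4))"
    by (simp add: sum_distrib_left)
  also have "\<dots> \<le> (\<Sum>i\<in>B. real (card (K i)) * min ((x i)\<^sup>2) (t\<^sup>2 / 4))"
  proof (intro sum_mono mult_right_mono)
    show "n / 4 \<le> real (card (K i))" for i using cardK[of i] by linarith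
  qed auto
  also have "\<dots> = (\<Sum>i\<in>B. \<Sum>k\<in>K i. min ((x i)\<^sup>2) (t\<^sup>2 / 4))" by simp
  also have "\<dots> \<le> (\<Sum>i\<in>B. \<Sum>k\<in>K i. min_sq i k)" by (intro sum_mono min_sq_ge)
  also have "\<dots> \<le> 4" by (intro sum_min_sq_subset_le) (auto simp: B_def K_def large_def)
  finally have tot: "(\<Sum>i\<in>B. min ((x i)\<^sup>2) (t\<^sup>2 / 4)) \<le> 16 / n" using n_pos by (simp add: field_simps)
  \<comment> \<open>The cap t^2/4 is at least 25/n, above the total 16/n, so it is never
    attained.\<close>
  have "min ((x i)\<^sup>2) (t\<^sup>2 / 4) = (x i)\<^sup>2" if "i \<in> B" for i
  proof -
    have "min ((x i)\<^sup>2) (t\<^sup>2 / 4) \<le> 16 / n"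
      using member_le_sum[OF that, of "\<lambda>i. min ((x i)\<^sup>2) (t\<^sup>2 / 4)"] fB tot by auto
    moreover have "16 / n < t\<^sup>2 / 4" using assms n_pos by (simp add: field_simps)
    ultimately show ?thesis by linarith
  qed
  then show ?thesis using tot by (simp add: B_def)
qed

lemma sum_small_x_le:
  assumes "t > 0" "100 \<le> real n * t\<^sup>2"
  shows "(\<Sum>i\<in>small n r x. (x i)\<^sup>2) \<le> (\<Sum>i\<in>small n r x \<inter> small n t y. (x i)\<^sup>2) + 16 / n"
proof -
  have "(\<Sum>i\<in>small n r x. (x i)\<^sup>2) \<le> (\<Sum>i\<in>(small n r x \<inter> small n t y) \<union> large n t y. (x i)\<^sup>2)"
    by (intro sum_mono2) (auto simp: small_def large_def)
  also have "\<dots> = (\<Sum>i\<in>small n r x \<inter> small n t y. (x i)\<^sup>2) + (\<Sum>i\<in>large n t y. (x i)\<^sup>2)"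
    by (intro sum.union_disjoint) (auto simp: small_def large_def)
  finally show ?thesis using large_y_sum_x_le[OF assms] by linarith
qed

text \<open>By Chebyshev the two exceptional sets have at most n/12 and n/8 elements: 36 = 12 * 3
  and 24 = 8 * 3, where 3 bounds the squared norms.\<close>

lemma card_outside_small:
  assumes "r > 0" "t > 0" "36 \<le> real n * r\<^sup>2" "24 \<le> real n * t\<^sup>2"
  shows "4 * real (card ({..<n} - small n r x \<inter> small n t y)) \<le> n"
proof -
  have "card ({..<n} - small n r x \<inter> small n t y) \<le> card (large n r x \<union> large n t y)"
    by (intro card_mono) (auto simp: small_def large_def)
  also have "\<dots> \<le> card (large n r x) + card (large n t y)" by (rule card_Un_le)
  finally have "real (card ({..<n} - small n r x \<inter> small n t y)) \<le> real (card (large n r x)) + real (card (large n t y))"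
    by linarith
  moreover have "12 * real (card (large n r x)) * r\<^sup>2 \<le> real n * r\<^sup>2"
    using card_large_sq_le[of r n x] x_le assms by linarith
  then have "12 * real (card (large n r x)) \<le> real n" using assms(1) by (simp add: mult_le_cancel_right)
  moreover have "8 * real (card (large n t y)) * t\<^sup>2 \<le> real n * t\<^sup>2"
    using card_large_sq_le[of t n y] y_le assms by linarith
  then have "8 * real (card (large n t y)) \<le> real n" using assms(2) by (simp add: mult_le_cancel_right)
  ultimately show ?thesis by linarith
qed

text \<open>Each side of the median 0 holds at least half of the vertices, so discarding at most a
  quarter leaves at least n/4 on each side, as \<open>sum_sq_shift_ge\<close> requires.\<close>

lemma bulk_spread_x:
  assumes "T \<subseteq> {..<n}" "4 * real (card ({..<n} - T)) \<le> n"
  shows "(\<Sum>i\<in>T. (x i)\<^sup>2) \<le> 10 * (\<Sum>i\<in>T. (x i - u)\<^sup>2)"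
proof (rule sum_sq_shift_ge)
  show "finite T" using assms(1) finite_subset by blast
  show "real (card T) \<le> real n" using card_mono[OF _ assms(1)] by simp
  have "n \<le> 4 * card {i \<in> T. P i}" if "n \<le> 2 * card {i. i < n \<and> P i}" for P
  proof -
    have "finite {i \<in> T. P i}" using \<open>finite T\<close> by simp
    then have "card {i. i < n \<and> P i} \<le> card ({i \<in> T. P i} \<union> ({..<n} - T))" by (intro card_mono) auto
    also have "\<dots> \<le> card {i \<in> T. P i} + card ({..<n} - T)" by (rule card_Un_le)
    finally show ?thesis using assms(2) that by linarith
  qed
  from this[OF x_neg] this[OF x_pos]
  show "real n \<le> 4 * real (card {i \<in> T. x i \<le> 0})" "real n \<le> 4 * real (card {i \<in> T. 0 \<le> x i})" by linarith+
qed

section \<open>Estimates at the threshold of order n^(-1/2)\<close>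

abbreviation s :: real where "s \<equiv> 20 * q ^ 3"

lemma s_pos: "0 < s" using q_pos by simp

text \<open>The factor 20 is chosen so that even s/2 meets the requirement 100 \<le> n t^2 of
  \<open>large_y_sum_x_le\<close>.\<close>

lemma n_s_sq: "real n * s\<^sup>2 = 400" and n_half_s_sq: "real n * (s / 2)\<^sup>2 = 100"
  using nq by (simp_all add: power_mult_distrib power_divide)

lemma q6_le: "16 * q ^ 6 \<le> q\<^sup>2 / 2"
proof -
  have "q ^ 4 = q\<^sup>2 * q\<^sup>2" by (simp flip: power_add)
  also have "\<dots> \<le> (1 / 2000000) * (1 / 2000000)" using q_small by (intro mult_mono) auto
  finally have "32 * q ^ 4 \<le> 1" by simp
  then have "32 * q ^ 4 * q\<^sup>2 \<le> 1 * q\<^sup>2" by (intro mult_right_mono) auto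
  moreover have "q ^ 4 * q\<^sup>2 = q ^ 6" by (simp flip: power_add)
  ultimately show ?thesis by (simp add: mult.assoc)
qed

text \<open>A single square is at most the whole sum, hence at most 16/n = (4 q^3)^2. The resulting
  bound is one fifth of \<open>s\<close>.\<close>

lemma large_y_abs_x_le:
  assumes "i \<in> large n s y"
  shows "\<bar>x i\<bar> \<le> 4 * q ^ 3"
proof -
  have "(x i)\<^sup>2 \<le> (\<Sum>i\<in>large n s y. (x i)\<^sup>2)" using assms by (intro member_le_sum) auto
  also have "\<dots> \<le> 16 / n" using large_y_sum_x_le[of s] s_pos n_s_sq by simp
  also have "\<dots> = (4 * q ^ 3)\<^sup>2" by (simp add: power_mult_distrib divide_n)
  finally have "\<bar>x i\<bar> \<le> \<bar>4 * q ^ 3\<bar>" by (simp only: abs_le_square_iff)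
  then show ?thesis using q_pos by simp
qed

text \<open>Where both entries are at most \<open>s\<close>, the product of the two squared
  differences is their maximum times their minimum, hence at most (2 s)^2 times
  \<open>min_sq\<close>. The budget makes the sum of these products O(q^6), whereas mass above q^2
  in both vectors would make it at least q^4/200 by \<open>sum_sq_diff_prod_ge\<close>.\<close>

lemma not_both_bulk: "(\<Sum>i\<in>small n s x. (x i)\<^sup>2) \<le> q\<^sup>2 \<or> (\<Sum>i\<in>small n s y. (y i)\<^sup>2) \<le> q\<^sup>2"
proof (rule ccontr)
  assume contra: "\<not> ?thesis"
  interpret sw: centred_pair n q F E y x by (rule swap)
  define T where "T = small n s x \<inter> small n s y"
  have T: "T \<subseteq> {..<n}" by (auto simp: T_def small_def)
  have cT: "4 * real (card ({..<n} - T)) \<le> n"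
    unfolding T_def using s_pos n_s_sq by (intro card_outside_small) simp_all
  have low_x: "q\<^sup>2 / 2 \<le> (\<Sum>i\<in>T. (x i)\<^sup>2)"
    using sum_small_x_le[of s s] contra s_pos n_s_sq q6_le unfolding T_def by (simp add: divide_n)
  have low_y: "q\<^sup>2 / 2 \<le> (\<Sum>i\<in>T. (y i)\<^sup>2)"
    using sw.sum_small_x_le[of s s] contra s_pos n_s_sq q6_le unfolding T_def by (simp add: divide_n Int_commute)
  have "2 * (q\<^sup>2 / 20 * (q\<^sup>2 / 20)) \<le> (\<Sum>i\<in>T. \<Sum>k\<in>T. (x i - x k)\<^sup>2 * (y i - y k)\<^sup>2)"
  proof (rule sum_sq_diff_prod_ge)
    show "finite T" by (simp add: T_def)
    show "q\<^sup>2 / 20 \<le> (\<Sum>i\<in>T. (x i - u)\<^sup>2)" for u using bulk_spread_x[OF T cT, of u] low_x by linarith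
    show "q\<^sup>2 / 20 \<le> (\<Sum>i\<in>T. (y i - u)\<^sup>2)" for u using sw.bulk_spread_x[OF T cT, of u] low_y by linarith
  qed auto
  also have "\<dots> \<le> (\<Sum>i\<in>T. \<Sum>k\<in>T. (2 * s)\<^sup>2 * min_sq i k)"
  proof (intro sum_mono)
    fix i k assume "i \<in> T" "k \<in> T"
    then have "\<bar>x i - x k\<bar> \<le> \<bar>2 * s\<bar>" "\<bar>y i - y k\<bar> \<le> \<bar>2 * s\<bar>"
      using s_pos by (auto simp: T_def small_def)
    then have "(x i - x k)\<^sup>2 \<le> (2 * s)\<^sup>2" "(y i - y k)\<^sup>2 \<le> (2 * s)\<^sup>2"
      by (simp_all only: abs_le_square_iff)
    then have "max ((x i - x k)\<^sup>2) ((y i - y k)\<^sup>2) * min_sq i k \<le> (2 * s)\<^sup>2 * min_sq i k"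
      by (intro mult_right_mono min_sq_nonneg) auto
    moreover have "max ((x i - x k)\<^sup>2) ((y i - y k)\<^sup>2) * min_sq i k = (x i - x k)\<^sup>2 * (y i - y k)\<^sup>2"
      by (simp add: min_sq_def max_def min_def)
    ultimately show "(x i - x k)\<^sup>2 * (y i - y k)\<^sup>2 \<le> (2 * s)\<^sup>2 * min_sq i k" by simp
  qed
  also have "\<dots> = (2 * s)\<^sup>2 * (\<Sum>i\<in>T. \<Sum>k\<in>T. min_sq i k)" by (simp add: sum_distrib_left)
  also have "\<dots> \<le> (2 * s)\<^sup>2 * 4" by (intro mult_left_mono sum_min_sq_subset_le T) auto
  also have "\<dots> = 6400 * q ^ 6" by (simp add: power_mult_distrib)
  \<comment> \<open>The factor is 200 * 6400; this comparison is the one that dictates the size of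
    the constant 2000000.\<close>
  finally have "q ^ 4 \<le> 1280000 * q ^ 6" by (simp flip: power_add)
  moreover have "q ^ 6 = q ^ 4 * q\<^sup>2" by (simp flip: power_add)
  ultimately have "q ^ 4 * 1 \<le> q ^ 4 * (1280000 * q\<^sup>2)" by argo
  then have "1 \<le> 1280000 * q\<^sup>2" using q_pos by (subst (asm) mult_le_cancel_left_pos) auto
  then show False using q_small by simp
qed

text \<open>From a vertex i with \<bar>y i\<bar> > s to the bulk \<open>T\<close>, the y-differences
  are at least s/2 = 10 q^3 and the x-differences at most 40 q^3, so \<open>min_sq\<close> is at
  least a sixteenth of the squared x-difference. By \<open>bulk_spread_x\<close> each such i uses
  q^2/320 of the budget 4.\<close>

lemma card_large_y_le:
  assumes "q\<^sup>2 < (\<Sum>i\<in>small n s x. (x i)\<^sup>2)"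
  shows "real (card (large n s y)) * q\<^sup>2 \<le> 1280"
proof -
  define T where "T = small n s x \<inter> small n (s / 2) y"
  have T: "T \<subseteq> {..<n}" by (auto simp: T_def small_def)
  have cT: "4 * real (card ({..<n} - T)) \<le> n"
    unfolding T_def using s_pos n_s_sq n_half_s_sq by (intro card_outside_small) simp_all
  have low: "q\<^sup>2 / 2 \<le> (\<Sum>i\<in>T. (x i)\<^sup>2)"
    using sum_small_x_le[of "s / 2" s] assms s_pos n_half_s_sq q6_le unfolding T_def by (simp add: divide_n)
  have row: "q\<^sup>2 / 320 \<le> (\<Sum>k\<in>T. min_sq i k)" if i: "i \<in> large n s y" for i
  proof -
    have "(x i - x k)\<^sup>2 / 16 \<le> min_sq i k" if k: "k \<in> T" for k
    proof -
      have "\<bar>x i - x k\<bar> \<le> 40 * q ^ 3" using large_y_abs_x_le[OF i] k s_pos by (auto simp: T_def small_def)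
      moreover have "10 * q ^ 3 \<le> \<bar>y i - y k\<bar>"
        using i k abs_triangle_ineq2[of "y i" "y k"] by (auto simp: T_def small_def large_def)
      ultimately have "\<bar>(x i - x k) / 4\<bar> \<le> \<bar>y i - y k\<bar>" by simp
      then have "((x i - x k) / 4)\<^sup>2 \<le> (y i - y k)\<^sup>2" by (simp only: abs_le_square_iff)
      then show ?thesis by (simp add: min_sq_def power_divide)
    qed
    then have "(\<Sum>k\<in>T. (x k - x i)\<^sup>2) / 16 \<le> (\<Sum>k\<in>T. min_sq i k)"
      unfolding sum_divide_distrib by (intro sum_mono) (simp add: power2_commute)
    then show ?thesis using bulk_spread_x[OF T cT, of "x i"] low by linarith
  qed
  have "real (card (large n s y)) * (q\<^sup>2 / 320) = (\<Sum>i\<in>large n s y. q\<^sup>2 / 320)" by simp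
  also have "\<dots> \<le> (\<Sum>i\<in>large n s y. \<Sum>k\<in>T. min_sq i k)" by (intro sum_mono row)
  also have "\<dots> \<le> 4" by (intro sum_min_sq_subset_le T) (auto simp: large_def)
  finally show ?thesis by simp
qed

text \<open>Where one vector exceeds \<open>s\<close> the other is at most s/5, so both differences
  keep at least half of their large entry. Squaring the halves costs the factor 4 on top of the
  budget 4.\<close>

lemma sum_min_large_le:
  "(\<Sum>i\<in>large n s x. \<Sum>k\<in>large n s y. min ((x i)\<^sup>2) ((y k)\<^sup>2)) \<le> 16"
proof -
  interpret sw: centred_pair n q F E y x by (rule swap)
  have "min ((x i)\<^sup>2) ((y k)\<^sup>2) / 4 \<le> min_sq i k" if i: "i \<in> large n s x" and k: "k \<in> large n s y" for i k
  proof -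
    have x_large: "s < \<bar>x i\<bar>" and y_large: "s < \<bar>y k\<bar>" using i k by (simp_all add: large_def)
    have "\<bar>x i / 2\<bar> \<le> \<bar>x i - x k\<bar>"
      using x_large large_y_abs_x_le[OF k] abs_triangle_ineq2[of "x i" "x k"] s_pos
      unfolding abs_divide abs_numeral by linarith
    then have "(x i / 2)\<^sup>2 \<le> (x i - x k)\<^sup>2" by (simp only: abs_le_square_iff)
    moreover have "\<bar>y k / 2\<bar> \<le> \<bar>y i - y k\<bar>"
      using y_large sw.large_y_abs_x_le[OF i] abs_triangle_ineq2[of "y k" "y i"] s_pos
      unfolding abs_divide abs_numeral by linarith
    then have "(y k / 2)\<^sup>2 \<le> (y i - y k)\<^sup>2" by (simp only: abs_le_square_iff)
    ultimately show ?thesis by (auto simp: min_sq_def power_divide)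
  qed
  then have "(\<Sum>i\<in>large n s x. \<Sum>k\<in>large n s y. min ((x i)\<^sup>2) ((y k)\<^sup>2) / 4)
      \<le> (\<Sum>i\<in>large n s x. \<Sum>k\<in>large n s y. min_sq i k)"
    by (intro sum_mono) auto
  also have "\<dots> \<le> 4" by (intro sum_min_sq_subset_le) (auto simp: large_def)
  finally show ?thesis by (simp flip: sum_divide_distrib)
qed

text \<open>Entries above 2 q contribute little, since \<bar>x i\<bar> \<le> (x i)^2 / (2 q) there; below 2 q
  the product \<bar>x i\<bar> \<bar>y k\<bar> is at most 2 q / s times the smaller of the two squares, which is
  what the budget controls.\<close>
lemma sum_large_truncated:
  assumes "3 / q < (\<Sum>i\<in>large n s x. \<bar>x i\<bar>)"
  shows "3 / (2 * q) < (\<Sum>i\<in>large n s x \<inter> small n (2 * q) x. \<bar>x i\<bar>)"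
proof -
  have "2 * q * (\<Sum>i\<in>large n (2 * q) x. \<bar>x i\<bar>) = (\<Sum>i\<in>large n (2 * q) x. 2 * q * \<bar>x i\<bar>)"
    by (simp add: sum_distrib_left)
  also have "\<dots> \<le> (\<Sum>i\<in>large n (2 * q) x. (x i)\<^sup>2)"
  proof (rule sum_mono)
    fix i assume "i \<in> large n (2 * q) x"
    then have "2 * q * \<bar>x i\<bar> \<le> \<bar>x i\<bar> * \<bar>x i\<bar>" by (intro mult_right_mono) (auto simp: large_def)
    then show "2 * q * \<bar>x i\<bar> \<le> (x i)\<^sup>2" by (simp add: power2_eq_square)
  qed
  also have "\<dots> \<le> (\<Sum>i<n. (x i)\<^sup>2)" by (intro sum_mono2) (auto simp: large_def)
  finally have "(\<Sum>i\<in>large n (2 * q) x. \<bar>x i\<bar>) \<le> 3 / (2 * q)"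
    using x_le q_pos by (simp add: field_simps)
  moreover have "(\<Sum>i\<in>large n s x. \<bar>x i\<bar>) \<le>
      (\<Sum>i\<in>large n s x \<inter> small n (2 * q) x. \<bar>x i\<bar>) + (\<Sum>i\<in>large n (2 * q) x. \<bar>x i\<bar>)"
    by (subst sum.union_disjoint[symmetric]) (auto simp: large_def small_def intro!: sum_mono2)
  moreover have "3 / q = 3 / (2 * q) + 3 / (2 * q)" using q_pos by (simp add: field_simps)
  ultimately show ?thesis using assms by linarith
qed

lemma sum_large_cases:
  "(\<Sum>i\<in>large n s x. \<bar>x i\<bar>) \<le> 3 / q \<or> (\<Sum>i\<in>large n s y. \<bar>y i\<bar>) \<le> 3 / q"
proof (rule ccontr)
  assume contra: "\<not> ?thesis"
  interpret sw: centred_pair n q F E y x by (rule swap)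
  define A B where "A = large n s x \<inter> small n (2 * q) x" and "B = large n s y \<inter> small n (2 * q) y"
  have "3 / (2 * q) * (3 / (2 * q)) \<le> (\<Sum>i\<in>A. \<bar>x i\<bar>) * (\<Sum>k\<in>B. \<bar>y k\<bar>)"
    using sum_large_truncated sw.sum_large_truncated contra q_pos unfolding A_def B_def
    by (intro mult_mono) (auto intro: sum_nonneg)
  then have "s * (3 / (2 * q) * (3 / (2 * q))) \<le> s * ((\<Sum>i\<in>A. \<bar>x i\<bar>) * (\<Sum>k\<in>B. \<bar>y k\<bar>))"
    using s_pos by (intro mult_left_mono) auto
  also have "\<dots> = (\<Sum>i\<in>A. \<Sum>k\<in>B. s * (\<bar>x i\<bar> * \<bar>y k\<bar>))"
    by (subst sum_product) (simp only: sum_distrib_left)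
  also have "\<dots> \<le> (\<Sum>i\<in>A. \<Sum>k\<in>B. 2 * q * min ((x i)\<^sup>2) ((y k)\<^sup>2))"
  proof (intro sum_mono)
    fix i k assume ik: "i \<in> A" "k \<in> B"
    \<comment> \<open>It is applied in both orders, since either square may be the minimum.\<close>
    have key: "s * (a * b) \<le> 2 * q * a\<^sup>2" if "s < a" "b \<le> 2 * q" "0 \<le> b" for a b :: real
    proof -
      have "s * b \<le> a * (2 * q)" using that s_pos by (intro mult_mono) linarith+
      moreover have "0 \<le> a" using that s_pos by linarith
      ultimately have "a * (s * b) \<le> a * (a * (2 * q))" by (intro mult_left_mono)
      then show ?thesis by (simp add: power2_eq_square algebra_simps)
    qed
    show "s * (\<bar>x i\<bar> * \<bar>y k\<bar>) \<le> 2 * q * min ((x i)\<^sup>2) ((y k)\<^sup>2)"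
      using key[of "\<bar>x i\<bar>" "\<bar>y k\<bar>"] key[of "\<bar>y k\<bar>" "\<bar>x i\<bar>"] ik
      by (auto simp: A_def B_def large_def small_def min_def mult.commute)
  qed
  also have "\<dots> = 2 * q * (\<Sum>i\<in>A. \<Sum>k\<in>B. min ((x i)\<^sup>2) ((y k)\<^sup>2))" by (simp add: sum_distrib_left)
  also have "\<dots> \<le> 2 * q * 16"
  proof (intro mult_left_mono)
    have "(\<Sum>i\<in>A. \<Sum>k\<in>B. min ((x i)\<^sup>2) ((y k)\<^sup>2)) \<le> (\<Sum>i\<in>large n s x. \<Sum>k\<in>large n s y. min ((x i)\<^sup>2) ((y k)\<^sup>2))"
      by (rule order_trans[OF sum_mono sum_mono2]) (auto simp: A_def B_def intro!: sum_mono2 sum_nonneg)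
    then show "(\<Sum>i\<in>A. \<Sum>k\<in>B. min ((x i)\<^sup>2) ((y k)\<^sup>2)) \<le> 16" using sum_min_large_le by linarith
  qed (use q_pos in auto)
  \<comment> \<open>The left side is 20 q^3 * (3 / (2 q))^2.\<close>
  finally have "45 * q \<le> 32 * q" using q_pos by (simp add: power3_eq_cube)
  then show False using q_pos by simp
qed

section \<open>Contradictions from the energies of the two graphs\<close>

lemma concentrated_y_contradiction:
  assumes my: "(\<Sum>i\<in>small n s y. (y i)\<^sup>2) \<le> q\<^sup>2" and sy: "(\<Sum>i\<in>large n s y. \<bar>y i\<bar>) \<le> 62 / q"
  shows False
proof -
  define B S where "B = large n s y" and "S = small n s y"
  have BS: "B \<subseteq> {..<n}" "S \<subseteq> {..<n}" "B \<inter> S = {}" "finite B" "finite S"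
    by (auto simp: B_def S_def large_def small_def)
  \<comment> \<open>Otherwise each j in \<open>B\<close> has an \<open>F\<close>-neighbour
    \<open>f j\<close> in \<open>S\<close>, and these edges alone give \<open>y\<close> energy at
    least 1 - q^2 - 2480 q^2, where 2480 = 2 * 20 * 62.\<close>
  have "\<exists>j\<in>B. \<forall>i\<in>S. \<not> F j i"
  proof (rule ccontr)
    assume "\<not> ?thesis"
    then obtain f where f: "\<And>j. j \<in> B \<Longrightarrow> f j \<in> S \<and> F j (f j)" by metis
    let ?g = "\<lambda>i k. if F i k then (y i - y k)\<^sup>2 else 0"
    have "(y j)\<^sup>2 - 2 * s * \<bar>y j\<bar> \<le> (\<Sum>k\<in>S. ?g j k)" if j: "j \<in> B" for j
    proof -
      have "\<bar>y (f j)\<bar> \<le> s" "s < \<bar>y j\<bar>" using f[OF j] j by (auto simp: S_def B_def small_def large_def)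
      then have "(\<bar>y j\<bar> - s)\<^sup>2 \<le> (y j - y (f j))\<^sup>2"
        using abs_triangle_ineq2[of "y j" "y (f j)"] by (intro abs_le_square_iff[THEN iffD1]) auto
      also have "\<dots> = ?g j (f j)" using f[OF j] by simp
      also have "\<dots> \<le> (\<Sum>k\<in>S. ?g j k)" using f[OF j] BS by (intro member_le_sum) auto
      finally have "(\<bar>y j\<bar> - s)\<^sup>2 \<le> (\<Sum>k\<in>S. ?g j k)" .
      moreover have "(\<bar>y j\<bar> - s)\<^sup>2 = (y j)\<^sup>2 - 2 * s * \<bar>y j\<bar> + s\<^sup>2" by (simp add: power2_diff)
      ultimately show ?thesis by (smt (verit) zero_le_power2)
    qed
    then have "(\<Sum>j\<in>B. (y j)\<^sup>2 - 2 * s * \<bar>y j\<bar>) \<le> (\<Sum>j\<in>B. \<Sum>k\<in>S. ?g j k)" by (rule sum_mono)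
    then have "2 * (\<Sum>j\<in>B. (y j)\<^sup>2 - 2 * s * \<bar>y j\<bar>) \<le> 2 * (\<Sum>j\<in>B. \<Sum>k\<in>S. ?g j k)" by simp
    also have "\<dots> \<le> (\<Sum>i<n. \<Sum>k<n. ?g i k)"
      using BS F_sym by (intro sum_disjoint_rectangle_le) (auto simp: power2_commute)
    also note QF
    finally have "(\<Sum>j\<in>B. (y j)\<^sup>2 - 2 * s * \<bar>y j\<bar>) < 1 - 2000000 * q\<^sup>2" by argo
    moreover have "(\<Sum>j\<in>B. (y j)\<^sup>2 - 2 * s * \<bar>y j\<bar>) = (\<Sum>j\<in>B. (y j)\<^sup>2) - 2 * s * (\<Sum>j\<in>B. \<bar>y j\<bar>)"
      by (simp add: sum_subtractf sum_distrib_left)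
    moreover have "1 - q\<^sup>2 \<le> (\<Sum>j\<in>B. (y j)\<^sup>2)"
      using sum_small_large[of "\<lambda>i. (y i)\<^sup>2" n s y] y_ge[of 0] my by (simp add: B_def)
    moreover have "2 * s * (\<Sum>j\<in>B. \<bar>y j\<bar>) \<le> 2 * s * (62 / q)"
      using sy s_pos by (intro mult_left_mono) (auto simp: B_def)
    moreover have "2 * s * (62 / q) = 2480 * q\<^sup>2" using q_pos by (simp add: power3_eq_cube power2_eq_square)
    ultimately have "1 - q\<^sup>2 - 2480 * q\<^sup>2 < 1 - 2000000 * q\<^sup>2" by linarith
    then show False using q_pos by simp
  qed
  then obtain j where j: "j \<in> B" "\<And>i. i \<in> S \<Longrightarrow> \<not> F j i" by auto
  have Ej: "E j i" if "i \<in> S" for i using cover[of j i] that j BS by auto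
  let ?h = "\<lambda>i k. if E i k then (x i - x k)\<^sup>2 else 0"
  have "2 * (\<Sum>i\<in>{j}. \<Sum>k\<in>S. ?h i k) \<le> (\<Sum>i<n. \<Sum>k<n. ?h i k)"
    using BS j E_sym by (intro sum_disjoint_rectangle_le) (auto simp: power2_commute)
  then have "(\<Sum>k\<in>S. (x j - x k)\<^sup>2) < 1 - 2000000 * q\<^sup>2" using QE Ej by simp
  \<comment> \<open>The variance bound is used about the point x j, so the star at j loses only the
    terms inside \<open>B\<close>, where \<open>x\<close> is nearly constant.\<close>
  moreover have "1 \<le> (\<Sum>k\<in>S. (x j - x k)\<^sup>2) + (\<Sum>k\<in>B. (x j - x k)\<^sup>2)"
    using sum_small_large[of "\<lambda>k. (x j - x k)\<^sup>2" n s y] x_ge[of "x j"] by (simp add: B_def S_def power2_commute)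
  moreover have "(\<Sum>k\<in>B. (x j - x k)\<^sup>2) \<le> (\<Sum>k\<in>B. 64 * q ^ 6)"
  proof (rule sum_mono)
    fix k assume "k \<in> B"
    then have "\<bar>x j - x k\<bar> \<le> \<bar>8 * q ^ 3\<bar>" using large_y_abs_x_le[of j] large_y_abs_x_le[of k] j q_pos by (auto simp: B_def)
    then have "(x j - x k)\<^sup>2 \<le> (8 * q ^ 3)\<^sup>2" by (simp only: abs_le_square_iff)
    then show "(x j - x k)\<^sup>2 \<le> 64 * q ^ 6" by (simp add: power_mult_distrib)
  qed
  moreover have "(\<Sum>k\<in>B. 64 * q ^ 6) \<le> 992 / 5 * q\<^sup>2"
  proof -
    have "real (card B) * s = (\<Sum>k\<in>B. s)" by simp
    also have "\<dots> \<le> (\<Sum>k\<in>B. \<bar>y k\<bar>)" by (intro sum_mono) (auto simp: B_def large_def)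
    finally have "real (card B) * s \<le> 62 / q" using sy by (simp add: B_def)
    \<comment> \<open>The multiplier is 64 q^6 / s, which turns the bound on card B * s into one on
      card B * 64 q^6.\<close>
    then have "real (card B) * s * (16 / 5 * q ^ 3) \<le> 62 / q * (16 / 5 * q ^ 3)" using q_pos by (intro mult_right_mono) auto
    then have "real (card B) * (64 * q ^ 6) \<le> 992 / 5 * q\<^sup>2"
      using q_pos by (simp add: power_eq_if field_simps)
    then show ?thesis by simp
  qed
  ultimately have "2000000 * q\<^sup>2 < 992 / 5 * q\<^sup>2" by linarith
  then show False using q_pos by simp
qed

text \<open>Mass of \<open>x\<close> on its small entries forces few large entries of
  \<open>y\<close>, and few entries with bounded squares have a bounded sum of absolute
  values.\<close>

lemma spread_x_contradiction:
  assumes "q\<^sup>2 < (\<Sum>i\<in>small n s x. (x i)\<^sup>2)"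
  shows False
proof (rule concentrated_y_contradiction)
  show "(\<Sum>i\<in>small n s y. (y i)\<^sup>2) \<le> q\<^sup>2" using not_both_bulk assms by linarith
  \<comment> \<open>The weights of this arithmetic-geometric mean bound yield 30/q from the squares
    and 32/q from the 1280/q^2 entries; hence the constant 62.\<close>
  have "(\<Sum>i\<in>large n s y. \<bar>y i\<bar>) \<le> (\<Sum>i\<in>large n s y. 10 / q * (y i)\<^sup>2 + q / 40)"
  proof (rule sum_mono)
    fix i
    have "0 \<le> (20 * \<bar>y i\<bar> - q)\<^sup>2" by simp
    then show "\<bar>y i\<bar> \<le> 10 / q * (y i)\<^sup>2 + q / 40" using q_pos by (simp add: power2_diff field_simps power2_eq_square)
  qed
  also have "\<dots> = 10 / q * (\<Sum>i\<in>large n s y. (y i)\<^sup>2) + real (card (large n s y)) * q / 40"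
    by (simp add: sum.distrib sum_distrib_left)
  also have "\<dots> \<le> 10 / q * 3 + 32 / q"
  proof (intro add_mono mult_left_mono)
    have "(\<Sum>i\<in>large n s y. (y i)\<^sup>2) \<le> (\<Sum>i<n. (y i)\<^sup>2)" by (intro sum_mono2) (auto simp: large_def)
    then show "(\<Sum>i\<in>large n s y. (y i)\<^sup>2) \<le> 3" using y_le by linarith
    show "real (card (large n s y)) * q / 40 \<le> 32 / q"
      using card_large_y_le[OF assms] q_pos by (simp add: field_simps power2_eq_square)
  qed (use q_pos in auto)
  finally show "(\<Sum>i\<in>large n s y. \<bar>y i\<bar>) \<le> 62 / q" by (simp add: add_divide_distrib[symmetric])
qed

text \<open>If neither vector has mass above q^2 on its small entries,
  \<open>sum_large_cases\<close> supplies the remaining hypothesis of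
  \<open>concentrated_y_contradiction\<close> for one of them.\<close>

lemma contradiction: False
proof -
  interpret sw: centred_pair n q F E y x by (rule swap)
  have "3 / q \<le> 62 / q" using q_pos by (simp add: field_simps)
  then show False
    using spread_x_contradiction sw.spread_x_contradiction sum_large_cases
      concentrated_y_contradiction sw.concentrated_y_contradiction by (meson not_le order_trans)
qed

end

subsection \<open>Algebraic connectivity\<close>

lemma algebraic_connectivity_test_vector:
  assumes n: "n \<ge> 2" and sym: "\<And>i k. i < n \<Longrightarrow> k < n \<Longrightarrow> E i k = E k i"
  obtains z :: "nat \<Rightarrow> real" where "(\<Sum>i<n. z i) = 0" "0 < (\<Sum>i<n. (z i)\<^sup>2)"
    "(\<Sum>i<n. \<Sum>k<n. if E i k then (z i - z k)\<^sup>2 else 0) \<le> 2 * (algebraic_connectivity n E * (\<Sum>i<n. (z i)\<^sup>2))"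
proof -
  let ?L = "laplacian n E"
  have L: "?L \<in> carrier_mat n n" by (simp add: laplacian_def)
  have symL: "?L $$ (i, j) = ?L $$ (j, i)" if "i < n" "j < n" for i j
    using that sym by (auto simp: laplacian_def)
  obtain fs where fs: "char_poly ?L = (\<Prod>a\<leftarrow>fs. [:- a, 1:])" "length fs = n"
    using symmetric_real_char_poly_splits[OF L symL] by blast
  define es where "es = sort fs"
  have es: "eigenvalues_sorted ?L = es" unfolding es_def by (rule eigenvalues_sorted_eq[OF L fs])
  have "mset (map (\<lambda>a. [:- a, 1:]) es) = mset (map (\<lambda>a. [:- a, 1:]) fs)" by (simp add: es_def)
  then have cp: "char_poly ?L = (\<Prod>a\<leftarrow>es. [:- a, 1:])" unfolding fs(1) by (metis prod_mset_prod_list)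
  have le: "es ! 0 \<le> es ! 1" using n fs(2) by (intro sorted_nth_mono) (auto simp: es_def)
  have "?L\<^sup>T = ?L" using L symL by (intro eq_matI) auto
  from second_eigenvalue_test_vector[OF L this cp n le, of "vec n (\<lambda>_. 1)"]
  obtain z where z: "z \<in> carrier_vec n" "z \<noteq> 0\<^sub>v n" "vec n (\<lambda>_. 1) \<bullet> z = 0"
    "z \<bullet> (?L *\<^sub>v z) \<le> es ! 1 * (z \<bullet> z)" by auto
  have zz: "z \<bullet> z = (\<Sum>i<n. (z $ i)\<^sup>2)"
    using z(1) by (simp add: scalar_prod_def lessThan_atLeast0 power2_eq_square)
  show ?thesis
  proof (rule that[of "\<lambda>i. z $ i"])
    show "(\<Sum>i<n. z $ i) = 0" using z(1,3) by (simp add: scalar_prod_def lessThan_atLeast0)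
    have "\<exists>i<n. z $ i \<noteq> 0" using z(1,2) by (metis carrier_vecD eq_vecI index_zero_vec)
    then show "0 < (\<Sum>i<n. (z $ i)\<^sup>2)" by (auto intro: sum_pos2)
    show "(\<Sum>i<n. \<Sum>k<n. if E i k then (z $ i - z $ k)\<^sup>2 else 0) \<le> 2 * (algebraic_connectivity n E * (\<Sum>i<n. (z $ i)\<^sup>2))"
      using laplacian_quadratic_form[where E = E, OF sym z(1)] z(4) unfolding algebraic_connectivity_def es zz by simp
  qed
qed

text \<open>Normalise to mean 0 and norm 1, then subtract a median \<open>c\<close>. Edge
  differences are unaffected, no translation lowers the sum of squares below 1, and this one adds n
  c^2 \<le> 2, whence the bound 3.\<close>

lemma centred_test_vector:
  assumes n: "n \<ge> 2" and sym: "\<And>i k. i < n \<Longrightarrow> k < n \<Longrightarrow> E i k = E k i"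
  obtains x :: "nat \<Rightarrow> real" where "\<And>u. 1 \<le> (\<Sum>i<n. (x i - u)\<^sup>2)" "(\<Sum>i<n. (x i)\<^sup>2) \<le> 3"
    "n \<le> 2 * card {i. i < n \<and> 0 \<le> x i}" "n \<le> 2 * card {i. i < n \<and> x i \<le> 0}"
    "(\<Sum>i<n. \<Sum>k<n. if E i k then (x i - x k)\<^sup>2 else 0) \<le> 2 * algebraic_connectivity n E"
proof -
  obtain z :: "nat \<Rightarrow> real" where z: "(\<Sum>i<n. z i) = 0" "0 < (\<Sum>i<n. (z i)\<^sup>2)"
    "(\<Sum>i<n. \<Sum>k<n. if E i k then (z i - z k)\<^sup>2 else 0) \<le> 2 * (algebraic_connectivity n E * (\<Sum>i<n. (z i)\<^sup>2))"
    using algebraic_connectivity_test_vector[where E = E, OF n sym] by blast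
  define N where "N = (\<Sum>i<n. (z i)\<^sup>2)"
  define v where "v i = z i / sqrt N" for i
  have N: "0 < N" using z(2) by (simp add: N_def)
  have v0: "(\<Sum>i<n. v i) = 0" using z(1) by (simp add: v_def flip: sum_divide_distrib)
  have v1: "(\<Sum>i<n. (v i)\<^sup>2) = 1"
    using N by (simp add: v_def power_divide flip: sum_divide_distrib) (simp add: N_def)
  have shift: "(\<Sum>i<n. (v i - u)\<^sup>2) = 1 + n * u\<^sup>2" for u :: real
  proof -
    have "(\<Sum>i<n. (v i - u)\<^sup>2) = (\<Sum>i<n. (v i)\<^sup>2 - 2 * u * v i + u\<^sup>2)"
      by (intro sum.cong refl) (simp add: power2_diff)
    then show ?thesis by (simp add: sum.distrib sum_subtractf v1 v0 flip: sum_distrib_left)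
  qed
  obtain c where c: "n \<le> 2 * card {i. i < n \<and> c \<le> v i}" "n \<le> 2 * card {i. i < n \<and> v i \<le> c}"
    using median_exists[of n v] n by auto
  \<comment> \<open>At least half of the entries lie beyond the median as seen from 0, so each has
    absolute value at least \<bar>c\<bar>; comparing with norm 1 bounds n c^2 by 2.\<close>
  have "\<exists>S \<subseteq> {..<n}. n \<le> 2 * card S \<and> (\<forall>i\<in>S. c\<^sup>2 \<le> (v i)\<^sup>2)"
  proof (cases "c \<ge> 0")
    case True
    then have "c\<^sup>2 \<le> (v i)\<^sup>2" if "c \<le> v i" for i using that by (intro power_mono) auto
    then show ?thesis using c(1) by (intro exI[of _ "{i. i < n \<and> c \<le> v i}"]) auto
  next
    case False
    then have "c\<^sup>2 \<le> (v i)\<^sup>2" if "v i \<le> c" for i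
      using that by (intro abs_le_square_iff[THEN iffD1]) auto
    then show ?thesis using c(2) by (intro exI[of _ "{i. i < n \<and> v i \<le> c}"]) auto
  qed
  then obtain S where S: "S \<subseteq> {..<n}" "n \<le> 2 * card S" "\<And>i. i \<in> S \<Longrightarrow> c\<^sup>2 \<le> (v i)\<^sup>2" by auto
  have "card S * c\<^sup>2 \<le> (\<Sum>i\<in>S. (v i)\<^sup>2)" using S(3) sum_mono[of S "\<lambda>_. c\<^sup>2"] by simp
  also have "\<dots> \<le> 1" unfolding v1[symmetric] using S(1) by (intro sum_mono2) auto
  finally have "(2 * card S) * c\<^sup>2 \<le> 2" by simp
  moreover have "real n * c\<^sup>2 \<le> (2 * card S) * c\<^sup>2" using S(2) by (intro mult_right_mono) (linarith, simp)
  ultimately have nc: "real n * c\<^sup>2 \<le> 2" by linarith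
  show ?thesis
  proof (rule that[of "\<lambda>i. v i - c"])
    show "1 \<le> (\<Sum>i<n. (v i - c - u)\<^sup>2)" for u using shift[of "c + u"] by (simp add: diff_diff_eq)
    show "(\<Sum>i<n. (v i - c)\<^sup>2) \<le> 3" using shift[of c] nc by simp
    have "(if E i k then (v i - c - (v k - c))\<^sup>2 else 0) = (if E i k then (z i - z k)\<^sup>2 else 0) / N" for i k
      using N by (simp add: v_def power_divide flip: diff_divide_distrib)
    then have "(\<Sum>i<n. \<Sum>k<n. if E i k then (v i - c - (v k - c))\<^sup>2 else 0) =
        (\<Sum>i<n. \<Sum>k<n. if E i k then (z i - z k)\<^sup>2 else 0) / N"
      by (simp only: sum_divide_distrib)
    also have "\<dots> \<le> 2 * algebraic_connectivity n E"
      using z(3) N unfolding N_def[symmetric] by (simp add: field_simps)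
    finally show "(\<Sum>i<n. \<Sum>k<n. if E i k then (v i - c - (v k - c))\<^sup>2 else 0) \<le> 2 * algebraic_connectivity n E" .
  qed (use c in auto)
qed

theorem theorem2:
  shows "\<exists>C::real. C > 0 \<and>
    (\<forall>n::nat. \<forall>E. n \<ge> 2 \<longrightarrow> simple_graph_on n E \<longrightarrow>
       max (algebraic_connectivity n E) (algebraic_connectivity n (graph_complement E))
         \<ge> 1 - C * real n powr (-1/3))"
proof (intro exI[of _ "2000000"] conjI allI impI)
  fix n :: nat and E
  assume n: "n \<ge> 2" and G: "simple_graph_on n E"
  let ?F = "graph_complement E"
  have E_sym: "E i k = E k i" and F_sym: "?F i k = ?F k i" if "i < n" "k < n" for i k
    using G that by (auto simp: simple_graph_on_def graph_complement_def)
  \<comment> \<open>With this \<open>q\<close> every quantity becomes an integer power: 1/n is q^6,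
    the threshold is of order q^3 and the error is of order q^2.\<close>
  define q where "q = real n powr (-1/6)"
  have q: "0 < q" using n by (simp add: q_def)
  have "q ^ 6 = real n powr (-1)" and q2: "q\<^sup>2 = real n powr (-1/3)"
    using n by (simp_all add: q_def powr_power)
  then have nq: "real n * q ^ 6 = 1" using n by (simp add: powr_minus)
  show "1 - 2000000 * real n powr (-1/3) \<le> max (algebraic_connectivity n E) (algebraic_connectivity n ?F)"
  proof (rule ccontr)
    assume "\<not> ?thesis"
    then have small: "algebraic_connectivity n E < 1 - 2000000 * q\<^sup>2" "algebraic_connectivity n ?F < 1 - 2000000 * q\<^sup>2"
      by (simp_all add: q2)
    obtain x where x: "\<And>u. 1 \<le> (\<Sum>i<n. (x i - u)\<^sup>2)" "(\<Sum>i<n. (x i)\<^sup>2) \<le> 3"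
      "n \<le> 2 * card {i. i < n \<and> 0 \<le> x i}" "n \<le> 2 * card {i. i < n \<and> x i \<le> 0}"
      "(\<Sum>i<n. \<Sum>k<n. if E i k then (x i - x k)\<^sup>2 else 0) \<le> 2 * algebraic_connectivity n E"
      using centred_test_vector[where E = E, OF n E_sym] by blast
    obtain y where y: "\<And>u. 1 \<le> (\<Sum>i<n. (y i - u)\<^sup>2)" "(\<Sum>i<n. (y i)\<^sup>2) \<le> 3"
      "n \<le> 2 * card {i. i < n \<and> 0 \<le> y i}" "n \<le> 2 * card {i. i < n \<and> y i \<le> 0}"
      "(\<Sum>i<n. \<Sum>k<n. if ?F i k then (y i - y k)\<^sup>2 else 0) \<le> 2 * algebraic_connectivity n ?F"
      using centred_test_vector[where E = ?F, OF n F_sym] by blast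
    \<comment> \<open>Energies are nonnegative, so the assumed strict upper bound already forces
      \<open>q\<close> to be small; no separate case for small n arises.\<close>
    have "0 \<le> (\<Sum>i<n. \<Sum>k<n. if E i k then (x i - x k)\<^sup>2 else 0)" by (intro sum_nonneg) auto
    then have "2000000 * q\<^sup>2 < 1" using x(5) small(1) by linarith
    then have "centred_pair n q E ?F x y"
      using q nq x y small E_sym F_sym
      by unfold_locales (auto simp: graph_complement_def)
    then show False by (rule centred_pair.contradiction)
  qed
qed simp

end
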